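(* Let $T=\langle T_\alpha:\alpha\in\omega_1\rangle$ be a tower in $\mathcal P(\omega)$ which is strictly increasing, i.e. for all $\beta<\alpha<\omega_1$ the set $T_\beta\setminus T_\alpha$ is finite and $T_\alpha\setminus T_\beta$ is infinite. Then there is a matrix $\langle A(m,\alpha): m\in\omega,\ \alpha\in\omega_1\rangle$ of subsets of $\omega$ with the following properties: (1) For each $m\in\omega$, $\langle A(m,\alpha):\alpha\in\omega_1\rangle$ is a subtower of $T$. (2) For all $m_0<m_1$ in $\omega$, all $\alpha\in\omega_1$ and all $r\in\omega$, the set $\{\beta<\alpha : A(m_0,\alpha)\cap A(m_1,\beta)\subseteq r\}$ is finite. (3) For all $\alpha\in\omega_1$ and all $\beta<\alpha$ there is $m_0\in\omega$ such that for all $m>m_0$, $A(m,\alpha)\cap T_\beta=A(m,\beta)$. (4) For all $\alpha\in\omega_1$, $T_\alpha=\bigcup\{A(m,\alpha):m\in\omega\}$, and this union is disjoint.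
   Context: For $X,Y\subseteq\omega$, $X\subseteq^* Y$ means $X\setminus Y$ is finite. A natural number $r$ is identified with $\{0,\dots,r-1\}$. A tower of height $\omega_1$ is a sequence $\langle T_\alpha:\alpha\in\omega_1\rangle$ of subsets of $\omega$ with $T_\beta\subseteq^*T_\alpha$ whenever $\beta<\alpha$. A subtower $S$ of $T$ is a tower $\langle S_\alpha:\alpha\in\omega_1\rangle$ with $S_\alpha\subseteq T_\alpha$ for every $\alpha$ and such that $S_\alpha\cap(T_\beta\setminus S_\beta)$ is finite for all $\beta<\alpha$. *)

theory Defs
  imports "HOL-Library.Countable_Set" "HOL-Library.Disjoint_Sets"
begin

text \<open>
  The first uncountable ordinal, as a well-ordered type: the field of the cardinal successor of
  the order of the natural numbers.  That this is \<open>\<omega>\<^sub>1\<close> up to order isomorphism is witnessed by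
  \<open>uncountable_UNIV_omega1\<close> and \<open>countable_lessThan_omega1\<close> below.
\<close>

typedef omega1 = "Field (cardSuc natLeq)"
proof -
  have "infinite (Field (cardSuc natLeq))"
    using cardSuc_finite[OF natLeq_Card_order] by (simp add: Field_natLeq)
  then show ?thesis
    by (metis ex_in_conv finite.emptyI)
qed

lemma Well_order_cardSuc_natLeq: "Well_order (cardSuc natLeq)"
  using cardSuc_Card_order[OF natLeq_Card_order] by (rule card_order_on_well_order_on)

instantiation omega1 :: wellorder
begin

definition less_eq_omega1 :: "omega1 \<Rightarrow> omega1 \<Rightarrow> bool" where
  "\<alpha> \<le> \<beta> \<longleftrightarrow> (Rep_omega1 \<alpha>, Rep_omega1 \<beta>) \<in> cardSuc natLeq"

definition less_omega1 :: "omega1 \<Rightarrow> omega1 \<Rightarrow> bool" where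
  "\<alpha> < \<beta> \<longleftrightarrow> \<alpha> \<le> \<beta> \<and> \<alpha> \<noteq> \<beta>" for \<alpha> \<beta> :: omega1

instance
proof
  interpret wo_rel "cardSuc natLeq"
    by (simp add: wo_rel_def Well_order_cardSuc_natLeq)
  fix \<alpha> \<beta> \<gamma> :: omega1
  show refl: "\<alpha> \<le> \<alpha>"
    using REFL Rep_omega1[of \<alpha>] by (simp add: less_eq_omega1_def refl_on_def)
  show "\<alpha> \<le> \<beta> \<Longrightarrow> \<beta> \<le> \<gamma> \<Longrightarrow> \<alpha> \<le> \<gamma>"
    using TRANS unfolding less_eq_omega1_def by (blast dest: transD)
  show antisym: "\<alpha> \<le> \<beta> \<Longrightarrow> \<beta> \<le> \<alpha> \<Longrightarrow> \<alpha> = \<beta>"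
    using ANTISYM unfolding less_eq_omega1_def by (metis antisymD Rep_omega1_inject)
  show "\<alpha> \<le> \<beta> \<or> \<beta> \<le> \<alpha>"
    using TOTALS Rep_omega1[of \<alpha>] Rep_omega1[of \<beta>] unfolding less_eq_omega1_def by blast
  show "\<alpha> < \<beta> \<longleftrightarrow> \<alpha> \<le> \<beta> \<and> \<not> \<beta> \<le> \<alpha>"
    using refl antisym by (auto simp: less_omega1_def)
next
  fix P :: "omega1 \<Rightarrow> bool" and \<alpha> :: omega1
  assume step: "\<And>\<alpha>. (\<And>\<beta>. \<beta> < \<alpha> \<Longrightarrow> P \<beta>) \<Longrightarrow> P \<alpha>"
  have "wf (inv_image (cardSuc natLeq - Id) Rep_omega1)"
    using Well_order_cardSuc_natLeq by (auto simp: well_order_on_def)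
  then show "P \<alpha>"
  proof (induction \<alpha> rule: wf_induct_rule)
    case (less \<alpha>)
    show ?case
    proof (rule step)
      fix \<beta>
      assume "\<beta> < \<alpha>"
      then show "P \<beta>"
        by (intro less) (simp add: less_omega1_def less_eq_omega1_def Rep_omega1_inject)
    qed
  qed
qed

end

lemma uncountable_UNIV_omega1:
  includes cardinal_syntax
  shows "uncountable (UNIV :: omega1 set)"
proof
  assume "countable (UNIV :: omega1 set)"
  then have "countable (range Rep_omega1)"
    by simp
  then have "countable (Field (cardSuc natLeq))"
    using type_definition.Rep_range[OF type_definition_omega1] by simp
  then obtain f :: "nat set \<Rightarrow> nat" where "inj_on f (Field (cardSuc natLeq))"
    by (auto simp: countable_def)
  then have "|Field (cardSuc natLeq)| \<le>o |UNIV :: nat set|"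
    using card_of_ordLeq by blast
  moreover have "|Field (cardSuc natLeq)| =o cardSuc natLeq"
    by (rule card_of_Field_ordIso[OF cardSuc_Card_order[OF natLeq_Card_order]])
  ultimately have "cardSuc natLeq \<le>o natLeq"
    by (metis ordIso_ordLeq_trans ordIso_symmetric ordLeq_ordIso_trans card_of_nat)
  then show False
    using not_ordLess_ordLeq[OF cardSuc_greater[OF natLeq_Card_order]] by (rule notE[rotated])
qed

lemma countable_lessThan_omega1:
  includes cardinal_syntax
  shows "countable {..<\<alpha> :: omega1}"
proof -
  have "|underS (cardSuc natLeq) (Rep_omega1 \<alpha>)| <o cardSuc natLeq"
    by (rule card_of_underS[OF cardSuc_Card_order[OF natLeq_Card_order] Rep_omega1])
  then have "|underS (cardSuc natLeq) (Rep_omega1 \<alpha>)| \<le>o natLeq"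
    by (rule iffD1[OF cardSuc_ordLeq_ordLess[OF natLeq_Card_order card_of_Card_order]])
  then have "|underS (cardSuc natLeq) (Rep_omega1 \<alpha>)| \<le>o |UNIV :: nat set|"
    by (rule ordLeq_ordIso_trans[OF _ ordIso_symmetric[OF card_of_nat]])
  then obtain f :: "nat set \<Rightarrow> nat" where "inj_on f (underS (cardSuc natLeq) (Rep_omega1 \<alpha>))"
    by (auto simp flip: card_of_ordLeq)
  then have "countable (underS (cardSuc natLeq) (Rep_omega1 \<alpha>))"
    by (auto simp: countable_def)
  moreover have "Rep_omega1 ` {..<\<alpha>} \<subseteq> underS (cardSuc natLeq) (Rep_omega1 \<alpha>)"
    by (auto simp: underS_def less_omega1_def less_eq_omega1_def Rep_omega1_inject)
  ultimately have "countable (Rep_omega1 ` {..<\<alpha>})"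
    using countable_subset by metis
  then show ?thesis
    by (rule countable_image_inj_on) (simp add: inj_on_def Rep_omega1_inject)
qed

definition almost_subset :: "nat set \<Rightarrow> nat set \<Rightarrow> bool"  (infix \<open>\<subseteq>\<^sup>*\<close> 50) where
  "X \<subseteq>\<^sup>* Y \<longleftrightarrow> finite (X - Y)"

definition tower :: "(omega1 \<Rightarrow> nat set) \<Rightarrow> bool" where
  "tower T \<longleftrightarrow> (\<forall>\<alpha>. \<forall>\<beta><\<alpha>. T \<beta> \<subseteq>\<^sup>* T \<alpha>)"

definition strictly_increasing :: "(omega1 \<Rightarrow> nat set) \<Rightarrow> bool" where
  "strictly_increasing T \<longleftrightarrow> (\<forall>\<alpha>. \<forall>\<beta><\<alpha>. finite (T \<beta> - T \<alpha>) \<and> infinite (T \<alpha> - T \<beta>))"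

definition subtower :: "(omega1 \<Rightarrow> nat set) \<Rightarrow> (omega1 \<Rightarrow> nat set) \<Rightarrow> bool" where
  "subtower S T \<longleftrightarrow> tower S \<and> (\<forall>\<alpha>. S \<alpha> \<subseteq> T \<alpha>) \<and>
     (\<forall>\<alpha>. \<forall>\<beta><\<alpha>. finite (S \<alpha> \<inter> (T \<beta> - S \<beta>)))"

end

theory Submission
  imports Defs
begin

text \<open>
  A matrix as required is the same thing as a family of colourings: give \<open>x \<in> T \<alpha>\<close> the colour
  \<open>C \<alpha> x = m\<close> if \<open>x \<in> A m \<alpha>\<close>.  The rows are subtowers, and \<open>A m \<alpha> \<inter> T \<beta> = A m \<beta>\<close> for almost all
  \<open>m\<close>, if and only if the family is coherent: \<open>C \<alpha>\<close> and \<open>C \<beta>\<close> differ at only finitely many points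
  of \<open>T \<alpha> \<inter> T \<beta>\<close>.  The remaining condition, on the intersections \<open>A m\<^sub>0 \<alpha> \<inter> A m\<^sub>1 \<beta>\<close>, says that for
  \<open>m\<^sub>0 < m\<^sub>1\<close> and any bound \<open>r\<close> only finitely many \<open>\<beta> < \<alpha>\<close> are missed, i.e. have no point \<open>x \<ge> r\<close>
  with \<open>C \<alpha> x = m\<^sub>0\<close> and \<open>C \<beta> x = m\<^sub>1\<close>.  Like a Hausdorff gap, such a family is built by transfinite
  recursion.  To leave room for later corrections, the recursion also maintains that every colour
  of \<open>C \<alpha>\<close> occurs infinitely often outside each earlier \<open>T \<beta>\<close>.

  If \<open>\<alpha>\<close> has an immediate predecessor \<open>\<gamma>\<close>, copy \<open>C \<gamma>\<close> on \<open>T \<gamma>\<close> and split the infinite set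
  \<open>T \<alpha> - T \<gamma>\<close> into infinite colour classes.  At a limit, enumerate the indices below \<open>\<alpha>\<close> as
  \<open>b 0, b 1, \<dots>\<close> and glue the colourings \<open>C (b n)\<close> (\<open>ex_coherent_colouring\<close>).  For a coherent
  colouring only finitely many indices below each \<open>\<gamma> < \<alpha>\<close> are missed (\<open>finite_missed_atMost\<close>), so each
  of them can be repaired by recolouring one point outside more and more of the sets \<open>T (b i)\<close>,
  which does not hurt coherence (\<open>ex_repair_colour\<close>).

  Repairs for different colours could undo each other; this is where \<open>m\<^sub>0 < m\<^sub>1\<close> matters.  A repair
  for the pair \<open>(m\<^sub>0, m\<^sub>1)\<close> changes the colour \<open>m\<^sub>1\<close> into the smaller colour \<open>m\<^sub>0\<close>, hence can only spoil
  points that serve pairs with a first component above \<open>m\<^sub>0\<close>.  Repairing for \<open>m\<^sub>0 = 0, 1, 2, \<dots>\<close> in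
  this order therefore never undoes earlier work, and since every point only goes down in colour,
  the repairs have a limit (\<open>ex_hausdorff_colouring\<close>).
\<close>

section \<open>Colourings of a tower\<close>

definition coherent ::
    "('i::order \<Rightarrow> nat set) \<Rightarrow> ('i \<Rightarrow> nat \<Rightarrow> nat) \<Rightarrow> 'i \<Rightarrow> (nat \<Rightarrow> nat) \<Rightarrow> bool" where
  "coherent T C \<alpha> v \<longleftrightarrow> (\<forall>\<beta><\<alpha>. finite {x \<in> T \<alpha> \<inter> T \<beta>. v x \<noteq> C \<beta> x})"

definition spread :: "('i::order \<Rightarrow> nat set) \<Rightarrow> 'i \<Rightarrow> (nat \<Rightarrow> nat) \<Rightarrow> bool" where
  "spread T \<alpha> v \<longleftrightarrow> (\<forall>\<beta><\<alpha>. \<forall>m. infinite {x \<in> T \<alpha> - T \<beta>. v x = m})"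

text \<open>
  With colour classes \<open>A m \<alpha>\<close> in place of colourings, this is the set of all \<open>\<beta> < \<alpha>\<close> such that
  \<open>A m\<^sub>0 \<alpha> \<inter> A m\<^sub>1 \<beta> \<subseteq> {..<r}\<close>.
\<close>

definition missed ::
    "('i::order \<Rightarrow> nat set) \<Rightarrow> ('i \<Rightarrow> nat \<Rightarrow> nat) \<Rightarrow> 'i \<Rightarrow> (nat \<Rightarrow> nat) \<Rightarrow> nat \<Rightarrow> nat \<Rightarrow> nat \<Rightarrow> 'i set"
  where
  "missed T C \<alpha> v m\<^sub>0 m\<^sub>1 r = {\<beta>. \<beta> < \<alpha> \<and> (\<forall>x \<in> T \<alpha> \<inter> T \<beta>. v x = m\<^sub>0 \<longrightarrow> C \<beta> x = m\<^sub>1 \<longrightarrow> x < r)}"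

definition admissible ::
    "('i::order \<Rightarrow> nat set) \<Rightarrow> ('i \<Rightarrow> nat \<Rightarrow> nat) \<Rightarrow> 'i \<Rightarrow> (nat \<Rightarrow> nat) \<Rightarrow> bool" where
  "admissible T C \<alpha> v \<longleftrightarrow> coherent T C \<alpha> v \<and> spread T \<alpha> v \<and>
     (\<forall>m\<^sub>0 m\<^sub>1 r. m\<^sub>0 < m\<^sub>1 \<longrightarrow> finite (missed T C \<alpha> v m\<^sub>0 m\<^sub>1 r))"

lemma admissible_cong:
  assumes "\<And>\<beta>. \<beta> < \<alpha> \<Longrightarrow> C \<beta> = C' \<beta>"
  shows "admissible T C \<alpha> v = admissible T C' \<alpha> v"
proof -
  have "coherent T C \<alpha> v = coherent T C' \<alpha> v"
    using assms by (simp add: coherent_def)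
  moreover have "missed T C \<alpha> v m\<^sub>0 m\<^sub>1 r = missed T C' \<alpha> v m\<^sub>0 m\<^sub>1 r" for m\<^sub>0 m\<^sub>1 r
    using assms by (auto simp: missed_def)
  ultimately show ?thesis
    by (simp add: admissible_def)
qed

lemma ex_infinite_colour_classes:
  fixes S :: "nat set"
  assumes "infinite S"
  shows "\<exists>h :: nat \<Rightarrow> nat. \<forall>m. infinite {x \<in> S. h x = m}"
proof -
  obtain D :: "nat \<Rightarrow> nat set" where D: "pairwise (\<lambda>i j. disjnt (D i) (D j)) UNIV"
      "(\<Union>i. D i) \<subseteq> S" "\<And>i. infinite (D i)"
    using infinite_infinite_partition[OF assms] by blast
  define h where "h x = (SOME i. x \<in> D i)" for x
  have "h x = m" if "x \<in> D m" for x m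
    using D(1) that someI[of "\<lambda>i. x \<in> D i" m]
    unfolding h_def pairwise_def disjnt_def by blast
  then have "D m \<subseteq> {x \<in> S. h x = m}" for m
    using D(2) by blast
  then show ?thesis
    using D(3) finite_subset by blast
qed

text \<open>
  The setting of one step of the recursion: \<open>\<alpha>\<close> is the index to be treated, and \<open>C\<close> is a family that
  is already as it should be below \<open>\<alpha>\<close>.
\<close>

locale recursion_step =
  fixes T :: "'i::wellorder \<Rightarrow> nat set" and C :: "'i \<Rightarrow> nat \<Rightarrow> nat" and \<alpha> :: 'i
  assumes almost_mono: "\<And>\<beta> \<gamma>. \<beta> < \<gamma> \<Longrightarrow> finite (T \<beta> - T \<gamma>)"
    and admissible_below: "\<And>\<beta>. \<beta> < \<alpha> \<Longrightarrow> admissible T C \<beta> (C \<beta>)"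
begin

lemma finite_disagreement_below:
  assumes "\<beta> < \<alpha>" "\<gamma> < \<alpha>"
  shows "finite {x \<in> T \<beta> \<inter> T \<gamma>. C \<beta> x \<noteq> C \<gamma> x}"
proof -
  have *: "finite {x \<in> T \<beta> \<inter> T \<gamma>. C \<beta> x \<noteq> C \<gamma> x}" if "\<gamma> < \<beta>" "\<beta> < \<alpha>" for \<beta> \<gamma>
    using admissible_below[of \<beta>] that by (auto simp: admissible_def coherent_def)
  have "{x \<in> T \<beta> \<inter> T \<gamma>. C \<beta> x \<noteq> C \<gamma> x} = {x \<in> T \<gamma> \<inter> T \<beta>. C \<gamma> x \<noteq> C \<beta> x}"
    by auto
  then show ?thesis
    using *[of \<beta> \<gamma>] *[of \<gamma> \<beta>] assms by (cases \<beta> \<gamma> rule: linorder_cases) auto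
qed

text \<open>
  An index \<open>\<beta> < \<gamma>\<close> missed by \<open>v\<close> is also missed by \<open>C \<gamma>\<close>, for a larger bound in place of \<open>r\<close> that
  absorbs the finitely many points where \<open>v\<close> deviates from \<open>C \<gamma>\<close>.
\<close>

lemma finite_missed_atMost:
  assumes v: "coherent T C \<alpha> v" and "\<gamma> < \<alpha>" and "m\<^sub>0 < m\<^sub>1"
  shows "finite (missed T C \<alpha> v m\<^sub>0 m\<^sub>1 r \<inter> {..\<gamma>})"
proof -
  define E where "E = {x \<in> T \<alpha> \<inter> T \<gamma>. v x \<noteq> C \<gamma> x} \<union> (T \<gamma> - T \<alpha>)"
  have "finite E"
    using v \<open>\<gamma> < \<alpha>\<close> almost_mono by (simp add: E_def coherent_def)
  then obtain s where s: "E \<subseteq> {..<s}"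
    using finite_nat_bounded by blast
  have "missed T C \<alpha> v m\<^sub>0 m\<^sub>1 r \<inter> {..\<gamma>} \<subseteq> insert \<gamma> (missed T C \<gamma> (C \<gamma>) m\<^sub>0 m\<^sub>1 (max r s))"
  proof
    fix \<beta>
    assume \<beta>: "\<beta> \<in> missed T C \<alpha> v m\<^sub>0 m\<^sub>1 r \<inter> {..\<gamma>}"
    have "x < max r s" if x: "x \<in> T \<gamma> \<inter> T \<beta>" "C \<gamma> x = m\<^sub>0" "C \<beta> x = m\<^sub>1" for x
    proof (cases "x \<in> E")
      case True
      then show ?thesis
        using s by auto
    next
      case False
      then have "x \<in> T \<alpha>" "v x = m\<^sub>0"
        using x by (auto simp: E_def)
      then show ?thesis
        using \<beta> x by (auto simp: missed_def)
    qed
    then show "\<beta> \<in> insert \<gamma> (missed T C \<gamma> (C \<gamma>) m\<^sub>0 m\<^sub>1 (max r s))"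
      using \<beta> by (auto simp: missed_def)
  qed
  moreover have "finite (missed T C \<gamma> (C \<gamma>) m\<^sub>0 m\<^sub>1 (max r s))"
    using admissible_below[OF \<open>\<gamma> < \<alpha>\<close>] \<open>m\<^sub>0 < m\<^sub>1\<close> by (simp add: admissible_def)
  ultimately show ?thesis
    by (meson finite.insertI finite_subset)
qed

section \<open>Successor steps\<close>

lemma ex_admissible_successor:
  assumes "\<gamma> < \<alpha>" and pred: "\<And>\<beta>. \<beta> < \<alpha> \<Longrightarrow> \<beta> \<le> \<gamma>" and new: "infinite (T \<alpha> - T \<gamma>)"
  shows "\<exists>v. admissible T C \<alpha> v"
proof -
  obtain h :: "nat \<Rightarrow> nat" where h: "\<And>m. infinite {x \<in> T \<alpha> - T \<gamma>. h x = m}"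
    using ex_infinite_colour_classes[OF new] by blast
  define v where "v x = (if x \<in> T \<gamma> then C \<gamma> x else h x)" for x
  have rest: "finite (T \<beta> - T \<gamma>)" if "\<beta> < \<alpha>" for \<beta>
    using pred[OF that] almost_mono by (cases "\<beta> = \<gamma>") auto
  have coh: "coherent T C \<alpha> v"
    unfolding coherent_def
  proof (intro allI impI)
    fix \<beta>
    assume "\<beta> < \<alpha>"
    have "{x \<in> T \<alpha> \<inter> T \<beta>. v x \<noteq> C \<beta> x} \<subseteq> {x \<in> T \<gamma> \<inter> T \<beta>. C \<gamma> x \<noteq> C \<beta> x} \<union> (T \<beta> - T \<gamma>)"
      by (auto simp: v_def)
    then show "finite {x \<in> T \<alpha> \<inter> T \<beta>. v x \<noteq> C \<beta> x}"
      using finite_disagreement_below[OF \<open>\<gamma> < \<alpha>\<close> \<open>\<beta> < \<alpha>\<close>] rest[OF \<open>\<beta> < \<alpha>\<close>]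
      by (meson finite_UnI finite_subset)
  qed
  moreover have "spread T \<alpha> v"
    unfolding spread_def
  proof (intro allI impI)
    fix \<beta> m
    assume "\<beta> < \<alpha>"
    have "{x \<in> T \<alpha> - T \<gamma>. h x = m} - (T \<beta> - T \<gamma>) \<subseteq> {x \<in> T \<alpha> - T \<beta>. v x = m}"
      by (auto simp: v_def)
    then show "infinite {x \<in> T \<alpha> - T \<beta>. v x = m}"
      using Diff_infinite_finite[OF rest[OF \<open>\<beta> < \<alpha>\<close>] h[of m]] finite_subset by blast
  qed
  moreover have "finite (missed T C \<alpha> v m\<^sub>0 m\<^sub>1 r)" if "m\<^sub>0 < m\<^sub>1" for m\<^sub>0 m\<^sub>1 r
  proof -
    have "missed T C \<alpha> v m\<^sub>0 m\<^sub>1 r \<inter> {..\<gamma>} = missed T C \<alpha> v m\<^sub>0 m\<^sub>1 r"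
      using pred by (auto simp: missed_def)
    then show ?thesis
      using finite_missed_atMost[OF coh \<open>\<gamma> < \<alpha>\<close> that, of r] by simp
  qed
  ultimately show ?thesis
    by (auto simp: admissible_def)
qed

section \<open>Limit steps\<close>

text \<open>
  A point takes its colour from the first \<open>T (b n)\<close> that contains it.  On \<open>T (b k)\<close> only the finitely
  many colourings \<open>C (b n)\<close> with \<open>n \<le> k\<close> are used, and each of them almost agrees with \<open>C (b k)\<close>.
\<close>

lemma ex_coherent_colouring:
  fixes b :: "nat \<Rightarrow> 'i"
  assumes b: "range b = {..<\<alpha>}"
  shows "\<exists>v. coherent T C \<alpha> v"
proof -
  define n where "n x = (LEAST n. x \<in> T (b n))" for x
  define v where "v x = C (b (n x)) x" for x
  have "finite {x \<in> T \<alpha> \<inter> T (b k). v x \<noteq> C (b k) x}" for k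
  proof -
    have "x \<in> (\<Union>n\<le>k. {x \<in> T (b n) \<inter> T (b k). C (b n) x \<noteq> C (b k) x})"
      if "x \<in> T (b k)" "v x \<noteq> C (b k) x" for x
    proof -
      have "x \<in> T (b (n x))" "n x \<le> k"
        using LeastI[of "\<lambda>n. x \<in> T (b n)" k] Least_le[of "\<lambda>n. x \<in> T (b n)" k] that
        by (auto simp: n_def)
      then show ?thesis
        using that by (auto simp: v_def)
    qed
    then have "{x \<in> T \<alpha> \<inter> T (b k). v x \<noteq> C (b k) x}
        \<subseteq> (\<Union>n\<le>k. {x \<in> T (b n) \<inter> T (b k). C (b n) x \<noteq> C (b k) x})"
      by blast
    moreover have "finite (\<Union>n\<le>k. {x \<in> T (b n) \<inter> T (b k). C (b n) x \<noteq> C (b k) x})"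
      using b by (intro finite_UN_I finite_disagreement_below) auto
    ultimately show ?thesis
      by (rule finite_subset)
  qed
  moreover have "\<exists>k. \<beta> = b k" if "\<beta> < \<alpha>" for \<beta>
    using b that by auto
  ultimately have "coherent T C \<alpha> v"
    unfolding coherent_def by metis
  then show ?thesis
    by blast
qed

text \<open>These are the points among which the repair for a missed \<open>\<beta>\<close> is chosen.\<close>

lemma infinite_colour_class_outside:
  assumes "\<beta> < \<alpha>" and G: "finite G" "G \<noteq> {}" "\<And>\<gamma>. \<gamma> \<in> G \<Longrightarrow> \<gamma> < \<beta>" and v: "coherent T C \<alpha> v"
  shows "infinite {x \<in> T \<alpha> \<inter> T \<beta> - (\<Union>\<gamma>\<in>G. T \<gamma>). v x = m \<and> C \<beta> x = m}"
proof -
  define \<mu> where "\<mu> = Max G"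
  have \<mu>: "\<mu> \<in> G" "\<And>\<gamma>. \<gamma> \<in> G \<Longrightarrow> \<gamma> \<le> \<mu>"
    using G by (auto simp: \<mu>_def)
  define E where
    "E = (\<Union>\<gamma>\<in>G. T \<gamma> - T \<mu>) \<union> (T \<beta> - T \<alpha>) \<union> {x \<in> T \<alpha> \<inter> T \<beta>. v x \<noteq> C \<beta> x}"
  have "finite (T \<gamma> - T \<mu>)" if "\<gamma> \<in> G" for \<gamma>
    using \<mu>(2)[OF that] almost_mono by (cases "\<gamma> = \<mu>") auto
  then have "finite E"
    unfolding E_def using G(1) almost_mono[OF \<open>\<beta> < \<alpha>\<close>] v \<open>\<beta> < \<alpha>\<close>
    by (intro finite_UnI finite_UN_I) (auto simp: coherent_def)
  moreover have "infinite {x \<in> T \<beta> - T \<mu>. C \<beta> x = m}"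
    using admissible_below[OF \<open>\<beta> < \<alpha>\<close>] G(3)[OF \<mu>(1)] by (simp add: admissible_def spread_def)
  ultimately have "infinite ({x \<in> T \<beta> - T \<mu>. C \<beta> x = m} - E)"
    by (rule Diff_infinite_finite)
  moreover have "{x \<in> T \<beta> - T \<mu>. C \<beta> x = m} - E
      \<subseteq> {x \<in> T \<alpha> \<inter> T \<beta> - (\<Union>\<gamma>\<in>G. T \<gamma>). v x = m \<and> C \<beta> x = m}"
    by (auto simp: E_def)
  ultimately show ?thesis
    using finite_subset by blast
qed

text \<open>
  All repairs for one colour \<open>m\<^sub>0\<close> at once.  The missed index \<open>\<beta>\<close> is repaired outside those \<open>T (b i)\<close>
  that precede the first \<open>b n \<ge> \<beta>\<close> in the enumeration, so that each \<open>T (b k)\<close> is met by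
  finitely many repairs.  No point of colour \<open>m\<^sub>0\<close> is lost, hence repairs do not interfere.
  The number \<open>N\<close> keeps the repairs off finitely many \<open>T (b i)\<close> altogether, which will
  permit carrying out infinitely many such steps in a row.
\<close>

lemma ex_repair_colour:
  fixes b :: "nat \<Rightarrow> 'i"
  assumes b: "range b = {..<\<alpha>}" and v: "coherent T C \<alpha> v"
  shows "\<exists>v'. coherent T C \<alpha> v' \<and>
    (\<forall>x. v' x \<noteq> v x \<longrightarrow> v' x = m\<^sub>0 \<and> m\<^sub>0 < v x \<and> (\<forall>i\<le>N. x \<notin> T (b i))) \<and>
    (\<forall>m\<^sub>1>m\<^sub>0. \<forall>r. finite (missed T C \<alpha> v' m\<^sub>0 m\<^sub>1 r))"
proof -
  define s where "s \<beta> = (LEAST n. \<beta> \<le> b n)" for \<beta>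
  have b_less: "b i < \<alpha>" for i
    using b by auto
  have le_s: "\<beta> \<le> b (s \<beta>)" if "\<beta> < \<alpha>" for \<beta>
  proof -
    have "\<exists>n. \<beta> \<le> b n"
      using b that by (metis imageE lessThan_iff order_refl)
    then show ?thesis
      unfolding s_def by (rule LeastI_ex[of "\<lambda>n. \<beta> \<le> b n"])
  qed
  have less_s: "b i < \<beta>" if "i < s \<beta>" for i \<beta>
    using not_less_Least[of i "\<lambda>n. \<beta> \<le> b n"] that by (auto simp: s_def)
  have "\<exists>x. x \<in> T \<alpha> \<inter> T \<beta> \<and> (\<forall>i<s \<beta>. x \<notin> T (b i)) \<and> v x = m \<and> C \<beta> x = m \<and> s \<beta> \<le> x"
    if "\<beta> < \<alpha>" "0 < s \<beta>" for \<beta> m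
  proof -
    have "infinite {x \<in> T \<alpha> \<inter> T \<beta> - (\<Union>\<gamma>\<in>b ` {..<s \<beta>}. T \<gamma>). v x = m \<and> C \<beta> x = m}"
      using that less_s by (intro infinite_colour_class_outside v) auto
    then show ?thesis
      unfolding infinite_nat_iff_unbounded_le by blast
  qed
  then obtain X where X: "\<And>\<beta> m. \<beta> < \<alpha> \<Longrightarrow> 0 < s \<beta> \<Longrightarrow>
      X \<beta> m \<in> T \<alpha> \<inter> T \<beta> \<and> (\<forall>i<s \<beta>. X \<beta> m \<notin> T (b i)) \<and> v (X \<beta> m) = m \<and> C \<beta> (X \<beta> m) = m \<and>
      s \<beta> \<le> X \<beta> m"
    by metis
  \<comment> \<open>Bounding both \<open>m\<^sub>1\<close> and the size of the points by \<open>s \<beta>\<close> leaves finitely many repairs at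
    each value of \<open>s \<beta>\<close>; nothing is lost, because only finitely many missed \<open>\<beta>\<close> have \<open>s \<beta>\<close> below
    given \<open>m\<^sub>1\<close>, \<open>r\<close> and \<open>N\<close>.\<close>
  define R where "R = {X \<beta> m\<^sub>1 |\<beta> m\<^sub>1. \<beta> \<in> missed T C \<alpha> v m\<^sub>0 m\<^sub>1 (s \<beta>) \<and>
    N < s \<beta> \<and> m\<^sub>0 < m\<^sub>1 \<and> m\<^sub>1 \<le> s \<beta>}"
  define v' where "v' x = (if x \<in> R then m\<^sub>0 else v x)" for x
  have R_off: "m\<^sub>0 < v x \<and> (\<forall>i\<le>N. x \<notin> T (b i))" if "x \<in> R" for x
    using that X by (fastforce simp: R_def missed_def)
  have R_fin: "finite (R \<inter> T (b k))" for k
  proof -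
    define P where "P = (SIGMA m\<^sub>1:{m\<^sub>0<..k}. \<Union>n\<le>k. missed T C \<alpha> v m\<^sub>0 m\<^sub>1 n \<inter> {..b n})"
    have "finite P"
      unfolding P_def by (intro finite_SigmaI finite_UN_I finite_missed_atMost v b_less) auto
    moreover have "R \<inter> T (b k) \<subseteq> (\<lambda>(m\<^sub>1, \<beta>). X \<beta> m\<^sub>1) ` P"
    proof
      fix x
      assume "x \<in> R \<inter> T (b k)"
      then obtain \<beta> m\<^sub>1 where x: "x = X \<beta> m\<^sub>1" "\<beta> \<in> missed T C \<alpha> v m\<^sub>0 m\<^sub>1 (s \<beta>)" "N < s \<beta>"
          "m\<^sub>0 < m\<^sub>1" "m\<^sub>1 \<le> s \<beta>" "x \<in> T (b k)"
        by (auto simp: R_def)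
      have "\<beta> < \<alpha>"
        using x by (simp add: missed_def)
      then have "s \<beta> \<le> k"
        using X[of \<beta> m\<^sub>1] x by (metis gr_implies_not0 gr0I not_le)
      then have "(m\<^sub>1, \<beta>) \<in> P"
        using x le_s[OF \<open>\<beta> < \<alpha>\<close>] by (auto simp: P_def)
      then show "x \<in> (\<lambda>(m\<^sub>1, \<beta>). X \<beta> m\<^sub>1) ` P"
        using x by force
    qed
    ultimately show ?thesis
      by (meson finite_imageI finite_subset)
  qed
  have v': "coherent T C \<alpha> v'"
    unfolding coherent_def
  proof (intro allI impI)
    fix \<beta>
    assume "\<beta> < \<alpha>"
    then obtain k where k: "\<beta> = b k"
      using b by auto
    have "{x \<in> T \<alpha> \<inter> T \<beta>. v' x \<noteq> C \<beta> x} \<subseteq> {x \<in> T \<alpha> \<inter> T \<beta>. v x \<noteq> C \<beta> x} \<union> (R \<inter> T (b k))"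
      by (auto simp: v'_def k)
    moreover have "finite {x \<in> T \<alpha> \<inter> T \<beta>. v x \<noteq> C \<beta> x}"
      using v \<open>\<beta> < \<alpha>\<close> by (simp add: coherent_def)
    ultimately show "finite {x \<in> T \<alpha> \<inter> T \<beta>. v' x \<noteq> C \<beta> x}"
      using R_fin by (meson finite_UnI finite_subset)
  qed
  have "finite (missed T C \<alpha> v' m\<^sub>0 m\<^sub>1 r)" if "m\<^sub>0 < m\<^sub>1" for m\<^sub>1 r
  proof -
    define K where "K = max N (max m\<^sub>1 r)"
    have "missed T C \<alpha> v' m\<^sub>0 m\<^sub>1 r \<subseteq> (\<Union>n\<le>K. missed T C \<alpha> v' m\<^sub>0 m\<^sub>1 r \<inter> {..b n})"
    proof
      fix \<beta>
      assume \<beta>: "\<beta> \<in> missed T C \<alpha> v' m\<^sub>0 m\<^sub>1 r"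
      then have "\<beta> < \<alpha>"
        by (simp add: missed_def)
      have "s \<beta> \<le> K"
      proof (rule ccontr)
        assume "\<not> s \<beta> \<le> K"
        then have big: "N < s \<beta>" "m\<^sub>1 < s \<beta>" "r < s \<beta>"
          by (auto simp: K_def)
        \<comment> \<open>Either \<open>v\<close> misses \<open>\<beta>\<close> and this has been repaired, or \<open>v\<close> has a point as desired, which has
          kept its colour \<open>m\<^sub>0\<close>.\<close>
        have "\<exists>x \<in> T \<alpha> \<inter> T \<beta>. v' x = m\<^sub>0 \<and> C \<beta> x = m\<^sub>1 \<and> s \<beta> \<le> x"
        proof (cases "\<beta> \<in> missed T C \<alpha> v m\<^sub>0 m\<^sub>1 (s \<beta>)")
          case True
          then have "X \<beta> m\<^sub>1 \<in> R"
            unfolding R_def using big \<open>m\<^sub>0 < m\<^sub>1\<close>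
            by (intro CollectI exI[of _ \<beta>] exI[of _ m\<^sub>1]) auto
          then show ?thesis
            using X[OF \<open>\<beta> < \<alpha>\<close>, of m\<^sub>1] big by (auto simp: v'_def)
        next
          case False
          then show ?thesis
            using \<open>\<beta> < \<alpha>\<close> by (force simp: missed_def v'_def)
        qed
        then show False
          using \<beta> big by (fastforce simp: missed_def)
      qed
      then show "\<beta> \<in> (\<Union>n\<le>K. missed T C \<alpha> v' m\<^sub>0 m\<^sub>1 r \<inter> {..b n})"
        using \<beta> le_s[OF \<open>\<beta> < \<alpha>\<close>] by blast
    qed
    moreover have "finite (\<Union>n\<le>K. missed T C \<alpha> v' m\<^sub>0 m\<^sub>1 r \<inter> {..b n})"
      by (intro finite_UN_I finite_missed_atMost v' b_less that) auto
    ultimately show ?thesis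
      by (rule finite_subset)
  qed
  moreover have "v' x = m\<^sub>0 \<and> m\<^sub>0 < v x \<and> (\<forall>i\<le>N. x \<notin> T (b i))" if "v' x \<noteq> v x" for x
    using that R_off by (auto simp: v'_def split: if_splits)
  ultimately show ?thesis
    using v' by blast
qed

text \<open>
  The repairs for \<open>m\<^sub>0 = 0, 1, 2, \<dots>\<close> in succession.  From step \<open>m\<close> on a point of colour at most \<open>m\<close> is
  never touched again, which gives both the existence of the limit and the survival of the
  repairs.  The limit is coherent because from step \<open>n\<close> on nothing changes on \<open>T (b n)\<close>.
\<close>

lemma ex_hausdorff_colouring:
  fixes b :: "nat \<Rightarrow> 'i"
  assumes b: "range b = {..<\<alpha>}"
  shows "\<exists>v. coherent T C \<alpha> v \<and> (\<forall>m\<^sub>0 m\<^sub>1 r. m\<^sub>0 < m\<^sub>1 \<longrightarrow> finite (missed T C \<alpha> v m\<^sub>0 m\<^sub>1 r))"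
proof -
  define Q where "Q m v v' \<longleftrightarrow>
      (\<forall>x. v' x \<noteq> v x \<longrightarrow> v' x = m \<and> m < v x \<and> (\<forall>i\<le>m. x \<notin> T (b i))) \<and>
      (\<forall>m\<^sub>1>m. \<forall>r. finite (missed T C \<alpha> v' m m\<^sub>1 r))" for m v v'
  have "\<exists>V. \<forall>m. coherent T C \<alpha> (V m) \<and> Q m (V m) (V (Suc m))"
  proof (rule dependent_nat_choice)
    show "\<exists>v. coherent T C \<alpha> v"
      by (rule ex_coherent_colouring[OF b])
    show "\<exists>v'. coherent T C \<alpha> v' \<and> Q m v v'" if "coherent T C \<alpha> v" for v m
      unfolding Q_def by (rule ex_repair_colour[OF b that])
  qed
  then obtain V where V: "\<And>m. coherent T C \<alpha> (V m)" "\<And>m. Q m (V m) (V (Suc m))"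
    by metis
  have change: "V (Suc m) x = m \<and> m < V m x \<and> (\<forall>i\<le>m. x \<notin> T (b i))"
    if "V (Suc m) x \<noteq> V m x" for m x
    using V(2)[of m] that by (simp add: Q_def)
  have fin: "finite (missed T C \<alpha> (V (Suc m)) m m\<^sub>1 r)" if "m < m\<^sub>1" for m m\<^sub>1 r
    using V(2)[of m] that by (simp add: Q_def)
  have stable: "V j x = V k x" if "V k x \<le> k" "k \<le> j" for j k x
    using that(2)
  proof (induction j rule: dec_induct)
    case (step j)
    then show ?case
      using change[of j x] that(1) by (metis leD le_trans)
  qed simp
  have stable_on: "V j x = V n x" if "x \<in> T (b n)" "n \<le> j" for j n x
    using that(2)
  proof (induction j rule: dec_induct)
    case (step j)
    then show ?case
      using change[of j x] that(1) by metis
  qed simp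
  have V_le: "V j x \<le> V 0 x" for j x
  proof (induction j)
    case (Suc j)
    then show ?case
      using change[of j x] by (cases "V (Suc j) x = V j x") auto
  qed simp
  define w where "w x = V (V 0 x) x" for x
  have w: "V j x = w x" if "V 0 x \<le> j" for j x
    unfolding w_def using that V_le stable by blast
  have "w x = V n x" if "x \<in> T (b n)" for n x
    using stable_on[OF that, of "max n (V 0 x)"] w[of x "max n (V 0 x)"] by simp
  then have "{x \<in> T \<alpha> \<inter> T (b n). w x \<noteq> C (b n) x} = {x \<in> T \<alpha> \<inter> T (b n). V n x \<noteq> C (b n) x}" for n
    by auto
  moreover have "finite {x \<in> T \<alpha> \<inter> T (b n). V n x \<noteq> C (b n) x}" for n
    using V(1)[of n] b by (auto simp: coherent_def)
  moreover have "\<exists>n. \<beta> = b n" if "\<beta> < \<alpha>" for \<beta>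
    using b that by auto
  ultimately have "coherent T C \<alpha> w"
    unfolding coherent_def by metis
  moreover have "finite (missed T C \<alpha> w m\<^sub>0 m\<^sub>1 r)" if "m\<^sub>0 < m\<^sub>1" for m\<^sub>0 m\<^sub>1 r
  proof -
    have "w x = m\<^sub>0" if "V (Suc m\<^sub>0) x = m\<^sub>0" for x
      using stable[of "Suc m\<^sub>0" x "max (Suc m\<^sub>0) (V 0 x)"] w[of x "max (Suc m\<^sub>0) (V 0 x)"] that
      by simp
    then have "missed T C \<alpha> w m\<^sub>0 m\<^sub>1 r \<subseteq> missed T C \<alpha> (V (Suc m\<^sub>0)) m\<^sub>0 m\<^sub>1 r"
      by (auto simp: missed_def)
    then show ?thesis
      using fin[OF that] finite_subset by blast
  qed
  ultimately show ?thesis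
    by blast
qed

text \<open>At a limit, the colour classes are spread out simply because those of the later \<open>C \<gamma>\<close> are.\<close>

lemma spread_limit:
  assumes v: "coherent T C \<alpha> v" and limit: "\<And>\<beta>. \<beta> < \<alpha> \<Longrightarrow> \<exists>\<gamma>. \<beta> < \<gamma> \<and> \<gamma> < \<alpha>"
  shows "spread T \<alpha> v"
  unfolding spread_def
proof (intro allI impI)
  fix \<beta> m
  assume "\<beta> < \<alpha>"
  then obtain \<gamma> where "\<beta> < \<gamma>" "\<gamma> < \<alpha>"
    using limit by blast
  then have "infinite {x \<in> T \<alpha> \<inter> T \<gamma> - (\<Union>\<beta>\<in>{\<beta>}. T \<beta>). v x = m \<and> C \<gamma> x = m}"
    by (intro infinite_colour_class_outside v) auto
  moreover have "{x \<in> T \<alpha> \<inter> T \<gamma> - (\<Union>\<beta>\<in>{\<beta>}. T \<beta>). v x = m \<and> C \<gamma> x = m}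
      \<subseteq> {x \<in> T \<alpha> - T \<beta>. v x = m}"
    by auto
  ultimately show "infinite {x \<in> T \<alpha> - T \<beta>. v x = m}"
    using finite_subset by blast
qed

section \<open>The recursion\<close>

lemma ex_admissible:
  assumes "countable {..<\<alpha>}" and new: "\<And>\<beta>. \<beta> < \<alpha> \<Longrightarrow> infinite (T \<alpha> - T \<beta>)"
  shows "\<exists>v. admissible T C \<alpha> v"
proof (cases "\<exists>\<gamma><\<alpha>. \<forall>\<beta><\<alpha>. \<beta> \<le> \<gamma>")
  case True
  then show ?thesis
    using ex_admissible_successor new by blast
next
  case limit: False
  show ?thesis
  proof (cases "{..<\<alpha>} = {}")
    case True
    then have "\<not> \<beta> < \<alpha>" for \<beta>
      by auto
    then show ?thesis
      by (simp add: admissible_def coherent_def spread_def missed_def)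
  next
    case False
    then have "range (from_nat_into {..<\<alpha>}) = {..<\<alpha>}"
      using assms(1) by simp
    then obtain v where v: "coherent T C \<alpha> v"
        "\<And>m\<^sub>0 m\<^sub>1 r. m\<^sub>0 < m\<^sub>1 \<Longrightarrow> finite (missed T C \<alpha> v m\<^sub>0 m\<^sub>1 r)"
      using ex_hausdorff_colouring by metis
    have "\<exists>\<gamma>. \<beta> < \<gamma> \<and> \<gamma> < \<alpha>" if "\<beta> < \<alpha>" for \<beta>
      using limit that by (metis not_le)
    then have "spread T \<alpha> v"
      by (rule spread_limit[OF v(1)])
    then show ?thesis
      using v by (auto simp: admissible_def)
  qed
qed

end

lemma ex_admissible_family:
  fixes T :: "'i::wellorder \<Rightarrow> nat set"
  assumes "\<And>\<alpha> :: 'i. countable {..<\<alpha>}"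
    and "\<And>\<alpha> \<beta>. \<beta> < \<alpha> \<Longrightarrow> finite (T \<beta> - T \<alpha>)" and "\<And>\<alpha> \<beta>. \<beta> < \<alpha> \<Longrightarrow> infinite (T \<alpha> - T \<beta>)"
  shows "\<exists>C. \<forall>\<alpha>. admissible T C \<alpha> (C \<alpha>)"
proof (rule dependent_wf_choice[OF wf, of "\<lambda>C \<alpha>. admissible T C \<alpha>"])
  fix C C' :: "'i \<Rightarrow> nat \<Rightarrow> nat" and \<alpha> v
  assume "\<And>\<beta>. (\<beta>, \<alpha>) \<in> {(x, y). x < y} \<Longrightarrow> C \<beta> = C' \<beta>"
  then show "admissible T C \<alpha> v = admissible T C' \<alpha> v"
    by (intro admissible_cong) simp
next
  fix C \<alpha>
  assume "\<And>\<beta>. (\<beta>, \<alpha>) \<in> {(x, y). x < y} \<Longrightarrow> admissible T C \<beta> (C \<beta>)"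
  then interpret recursion_step T C \<alpha>
    using assms(2) by unfold_locales auto
  show "\<exists>v. admissible T C \<alpha> v"
    using assms(1,3) by (rule ex_admissible)
qed

theorem theorem17:
  fixes T :: "omega1 \<Rightarrow> nat set"
  assumes "tower T" and "strictly_increasing T"
  shows "\<exists>A :: nat \<Rightarrow> omega1 \<Rightarrow> nat set.
    (\<forall>m. subtower (\<lambda>\<alpha>. A m \<alpha>) T) \<and>
    (\<forall>m\<^sub>0 m\<^sub>1. m\<^sub>0 < m\<^sub>1 \<longrightarrow>
       (\<forall>\<alpha>. \<forall>r::nat. finite {\<beta>. \<beta> < \<alpha> \<and> A m\<^sub>0 \<alpha> \<inter> A m\<^sub>1 \<beta> \<subseteq> {..<r}})) \<and>
    (\<forall>\<alpha>. \<forall>\<beta><\<alpha>. \<exists>m\<^sub>0. \<forall>m>m\<^sub>0. A m \<alpha> \<inter> T \<beta> = A m \<beta>) \<and>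
    (\<forall>\<alpha>. T \<alpha> = (\<Union>m. A m \<alpha>) \<and> disjoint_family (\<lambda>m. A m \<alpha>))"
proof -
  have mono: "finite (T \<beta> - T \<alpha>)" and new: "infinite (T \<alpha> - T \<beta>)" if "\<beta> < \<alpha>" for \<alpha> \<beta>
    using assms(2) that by (auto simp: strictly_increasing_def)
  obtain C where C: "\<And>\<alpha>. admissible T C \<alpha> (C \<alpha>)"
    using ex_admissible_family[of T] countable_lessThan_omega1 mono new by blast
  define A where "A m \<alpha> = {x \<in> T \<alpha>. C \<alpha> x = m}" for m \<alpha>
  \<comment> \<open>Outside this finite set, \<open>T \<beta>\<close> is contained in \<open>T \<alpha>\<close> and carries the same colours for both.\<close>
  define E where "E \<alpha> \<beta> = {x \<in> T \<alpha> \<inter> T \<beta>. C \<alpha> x \<noteq> C \<beta> x} \<union> (T \<beta> - T \<alpha>)" for \<alpha> \<beta>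
  have E: "finite (E \<alpha> \<beta>)" if "\<beta> < \<alpha>" for \<alpha> \<beta>
    using C[of \<alpha>] mono that by (simp add: E_def admissible_def coherent_def)
  have sub: "subtower (\<lambda>\<alpha>. A m \<alpha>) T" for m
  proof -
    have "finite (A m \<beta> - A m \<alpha>)" "finite (A m \<alpha> \<inter> (T \<beta> - A m \<beta>))" if "\<beta> < \<alpha>" for \<alpha> \<beta>
      by (rule finite_subset[OF _ E[OF that]]; auto simp: A_def E_def)+
    then show ?thesis
      by (auto simp: subtower_def tower_def almost_subset_def A_def)
  qed
  have miss: "finite {\<beta>. \<beta> < \<alpha> \<and> A m\<^sub>0 \<alpha> \<inter> A m\<^sub>1 \<beta> \<subseteq> {..<r}}" if "m\<^sub>0 < m\<^sub>1" for m\<^sub>0 m\<^sub>1 \<alpha> r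
  proof -
    have "{\<beta>. \<beta> < \<alpha> \<and> A m\<^sub>0 \<alpha> \<inter> A m\<^sub>1 \<beta> \<subseteq> {..<r}} = missed T C \<alpha> (C \<alpha>) m\<^sub>0 m\<^sub>1 r"
      by (auto simp: missed_def A_def)
    then show ?thesis
      using C[of \<alpha>] that by (simp add: admissible_def)
  qed
  have agree: "\<exists>m\<^sub>0. \<forall>m>m\<^sub>0. A m \<alpha> \<inter> T \<beta> = A m \<beta>" if "\<beta> < \<alpha>" for \<alpha> \<beta>
  proof -
    obtain m\<^sub>0 where m\<^sub>0: "C \<alpha> ` E \<alpha> \<beta> \<union> C \<beta> ` E \<alpha> \<beta> \<subseteq> {..<m\<^sub>0}"
      using finite_nat_bounded E[OF \<open>\<beta> < \<alpha>\<close>] by (meson finite_UnI finite_imageI)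
    have "x \<in> A m \<alpha> \<inter> T \<beta> \<longleftrightarrow> x \<in> A m \<beta>" if "m\<^sub>0 < m" for m x
    proof (cases "x \<in> E \<alpha> \<beta>")
      case True
      then have "C \<alpha> x < m" "C \<beta> x < m"
        using m\<^sub>0 that by auto
      then show ?thesis
        by (simp add: A_def)
    next
      case False
      then show ?thesis
        by (auto simp: A_def E_def)
    qed
    then show ?thesis
      by blast
  qed
  have union: "T \<alpha> = (\<Union>m. A m \<alpha>)" and disj: "disjoint_family (\<lambda>m. A m \<alpha>)" for \<alpha>
    by (auto simp: A_def disjoint_family_on_def)
  show ?thesis
    by (intro exI[of _ A] conjI allI impI sub miss agree union disj)
qed

end
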